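(* Let $\kappa$ be an infinite cardinal, let $X$ be a set and let $n\geq 1$ and $R\subseteq X^n$. Assume: (1) $|X|\geq\kappa^+$; (2) for all $a_1,\dots,a_{n-1}\in X$, $|\{a_0\in X: R(a_0,a_1,\dots,a_{n-1})\}|<\kappa$; (3) for every subset $A\subseteq X$ with $|A|=n$, there exist $a\in A$ and a tuple $\bar a\in(A\setminus\{a\})^{n-1}$ such that $R(a,\bar a)$ holds. Then there is a partition of $\{1,\dots,n-1\}$ into nonempty disjoint sets $u,v$ such that, letting $x=(x_i)_{i\in u\cup\{0\}}$ and $y=(x_i)_{i\in v}$, the partitioned formula $\phi(x,y):=R(x_0,x_1,\dots,x_{n-1})$ has IP in the structure $(X;R)$.
   Context: For a set $Y$ and a family $\mathcal G\subseteq\mathcal P(Y)$, a subset $A\subseteq Y$ is shattered by $\mathcal G$ if for every $S\subseteq A$ there is $G\in\mathcal G$ with $G\cap A=S$. A partitioned formula $\phi(x,y)$ has IP in a structure $N$ if for every $n<\omega$ some subset of $N^x$ of size $n$ is shattered by the family $\{\phi(N^x,b): b\in N^y\}$. *)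

theory Defs
  imports Main "HOL-Library.FuncSet"
begin

unbundle cardinal_syntax

definition shattered :: "'a set set \<Rightarrow> 'a set \<Rightarrow> bool" where
  "shattered \<G> A \<longleftrightarrow> (\<forall>S. S \<subseteq> A \<longrightarrow> (\<exists>G\<in>\<G>. G \<inter> A = S))"

text \<open>
  Tuples indexed by a set \<open>I\<close> of variable indices with entries in \<open>N\<close> are elements of
  \<open>I \<rightarrow>\<^sub>E N\<close>.  A formula is given by the set \<open>\<phi>\<close> of assignments of all its variables satisfying it.  Its
  partition has object variables indexed by \<open>I\<close> and parameter variables indexed by the disjoint
  set \<open>J\<close>; the assignment made of \<open>a \<in> I \<rightarrow>\<^sub>E N\<close> and \<open>b \<in> J \<rightarrow>\<^sub>E N\<close> is
  \<open>override_on b a I \<in> I \<union> J \<rightarrow>\<^sub>E N\<close>.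
\<close>

definition solution_set ::
  "'a set \<Rightarrow> ('i \<Rightarrow> 'a) set \<Rightarrow> 'i set \<Rightarrow> ('i \<Rightarrow> 'a) \<Rightarrow> ('i \<Rightarrow> 'a) set" where
  "solution_set N \<phi> I b = {a \<in> I \<rightarrow>\<^sub>E N. override_on b a I \<in> \<phi>}"

definition has_IP :: "'a set \<Rightarrow> ('i \<Rightarrow> 'a) set \<Rightarrow> 'i set \<Rightarrow> 'i set \<Rightarrow> bool" where
  "has_IP N \<phi> I J \<longleftrightarrow>
     (\<forall>m::nat. \<exists>A. A \<subseteq> (I \<rightarrow>\<^sub>E N) \<and> finite A \<and> card A = m \<and>
        shattered {solution_set N \<phi> I b | b. b \<in> J \<rightarrow>\<^sub>E N} A)"

end

theory Submission
  imports Defs Complex_Main "HOL-Library.Disjoint_Sets"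
begin

text \<open>
  Call a set null if it has size at most \<open>\<kappa>\<close>, and let \<open>F D\<close> be the set of all \<open>a\<close> with
  \<open>R(a, t)\<close> for some tuple \<open>t\<close> from \<open>D\<close>.  For \<open>n = 2\<close> the hypotheses are contradictory: take
  \<open>K \<subseteq> X\<close> of size \<open>\<kappa>\<close> and \<open>b\<close> outside \<open>K\<close> and all \<open>F {k}\<close>; then \<open>K \<subseteq> F {b}\<close>.  If no partition has
  IP, the general case reduces to this one by eliminating one parameter \<open>b\<close> at a time.  By the
  Sauer-Shelah lemma, the sets \<open>{b. a \<in> F (insert b D)}\<close> cut out only polynomially many cells, so
  there is a finite partition of the parameters such that each such set splits only a small fraction
  of its non-null cells: otherwise the number of non-null cells could be made to grow
  exponentially.  Replacing \<open>b\<close> by ultrafilters on these cells and \<open>a \<in> F (insert b D)\<close> by its truth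
  for a fixed fraction of the ultrafilters preserves all hypotheses, with one variable fewer.

  Constant tuples \<open>(b, \<dots>, b)\<close> correspond to \<open>u = {}\<close>, where nothing is known about IP, and have to be
  kept apart: \<open>H b\<close> is the set of all \<open>a\<close> with \<open>R(a, b, \<dots>, b)\<close>.
\<close>

section \<open>Growth of set systems\<close>

text \<open>Induction on \<open>K\<close>: split \<open>\<F>\<close> by membership of the new point
  \<open>x\<close> and trace both halves on the rest. A set shattered by either half is shattered by
  \<open>\<F>\<close>; one shattered by both stays shattered after inserting \<open>x\<close>.
  Inclusion-exclusion adds the counts.\<close>

lemma card_le_card_shattered:
  assumes "finite K" and "\<F> \<subseteq> Pow K"
  shows "card \<F> \<le> card {A. A \<subseteq> K \<and> shattered \<F> A}"
  using assms
proof (induction K arbitrary: \<F> rule: finite_induct)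
  case empty
  then consider "\<F> = {}" | "\<F> = {{}}" by (auto simp: subset_singleton_iff)
  then show ?case
  proof cases
    case 2
    then have "{A. A \<subseteq> {} \<and> shattered \<F> A} = {{}}" by (auto simp: shattered_def)
    with 2 show ?thesis by simp
  qed simp
next
  case (insert x K)
  define \<F>0 where "\<F>0 = {G \<in> \<F>. x \<notin> G}"
  define \<F>1 where "\<F>1 = (\<lambda>G. G - {x}) ` {G \<in> \<F>. x \<in> G}"
  define sh where "sh \<G> = {A. A \<subseteq> K \<and> shattered \<G> A}" for \<G>
  have fin: "finite \<F>" using insert by (meson finite_Pow_iff finite_insert finite_subset)
  have fsh: "finite (sh \<G>)" for \<G> unfolding sh_def using insert(1) by simp
  have F1: "G \<in> \<F>1 \<longleftrightarrow> x \<notin> G \<and> insert x G \<in> \<F>" for G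
    unfolding \<F>1_def by (auto simp: image_iff insert_absorb intro!: bexI[of _ "insert x G"])
  have "card \<F>1 = card {G \<in> \<F>. x \<in> G}"
    unfolding \<F>1_def by (rule card_image) (auto simp: inj_on_def)
  moreover have "card \<F> = card {G \<in> \<F>. x \<in> G} + card \<F>0"
    unfolding \<F>0_def using fin by (subst card_Un_disjoint [symmetric]) (auto intro!: arg_cong[of _ _ card])
  ultimately have "card \<F> = card \<F>1 + card \<F>0" by simp
  also have "card \<F>1 \<le> card (sh \<F>1)" unfolding sh_def
    using insert(4) by (intro insert(3)) (auto simp: \<F>1_def)
  also have "card \<F>0 \<le> card (sh \<F>0)" unfolding sh_def
    using insert(4) by (intro insert(3)) (auto simp: \<F>0_def)
  also have "card (sh \<F>1) + card (sh \<F>0) = card (sh \<F>1 \<union> sh \<F>0) + card (sh \<F>1 \<inter> sh \<F>0)"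
    by (rule card_Un_Int[OF fsh fsh])
  also have "card (sh \<F>1 \<inter> sh \<F>0) = card (insert x ` (sh \<F>1 \<inter> sh \<F>0))"
    using insert(2) by (intro card_image[symmetric]) (auto simp: inj_on_def sh_def)
  also have "card (sh \<F>1 \<union> sh \<F>0) + \<dots> = card ((sh \<F>1 \<union> sh \<F>0) \<union> insert x ` (sh \<F>1 \<inter> sh \<F>0))"
    using insert(2) fsh by (intro card_Un_disjoint[symmetric]) (auto simp: sh_def)
  also have "\<dots> \<le> card {A. A \<subseteq> insert x K \<and> shattered \<F> A}"
  proof (rule card_mono)
    have "shattered \<F> A" if A: "A \<in> sh \<F>1" for A
      unfolding shattered_def
    proof (intro allI impI)
      fix S assume "S \<subseteq> A"
      then obtain G where "G \<in> \<F>1" "G \<inter> A = S"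
        using A unfolding sh_def shattered_def by blast
      moreover have "x \<notin> A" using A insert(2) by (auto simp: sh_def)
      ultimately show "\<exists>G\<in>\<F>. G \<inter> A = S" using F1 by (intro bexI[of _ "insert x G"]) auto
    qed
    moreover have "shattered \<F> A" if "A \<in> sh \<F>0" for A
      using that unfolding sh_def shattered_def \<F>0_def by blast
    moreover have "shattered \<F> (insert x A)" if A: "A \<in> sh \<F>1" "A \<in> sh \<F>0" for A
      unfolding shattered_def
    proof (intro allI impI)
      have sh1: "\<exists>G\<in>\<F>1. G \<inter> A = S" and sh0: "\<exists>G\<in>\<F>0. G \<inter> A = S" if "S \<subseteq> A" for S
        using A that by (simp_all add: sh_def shattered_def)
      fix S assume S: "S \<subseteq> insert x A"
      show "\<exists>G\<in>\<F>. G \<inter> insert x A = S"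
      proof (cases "x \<in> S")
        case True
        from S have "S - {x} \<subseteq> A" by auto
        from sh1[OF this] obtain G where "G \<in> \<F>1" "G \<inter> A = S - {x}" by blast
        then have "insert x G \<inter> insert x A = S" using True by blast
        moreover have "insert x G \<in> \<F>" using F1 \<open>G \<in> \<F>1\<close> by simp
        ultimately show ?thesis by blast
      next
        case False
        with S have "S \<subseteq> A" by auto
        from sh0[OF this] obtain G where "G \<in> \<F>0" "G \<inter> A = S" by blast
        then have "G \<in> \<F>" "x \<notin> G" by (simp_all add: \<F>0_def)
        moreover have "G \<inter> insert x A = S" using \<open>x \<notin> G\<close> \<open>G \<inter> A = S\<close> by blast
        ultimately show ?thesis by blast
      qed
    qed
    ultimately show "(sh \<F>1 \<union> sh \<F>0) \<union> insert x ` (sh \<F>1 \<inter> sh \<F>0)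
        \<subseteq> {A. A \<subseteq> insert x K \<and> shattered \<F> A}"
      by (auto simp: sh_def)
  qed (use insert(1) in simp)
  finally show ?case by simp
qed

lemma card_small_subsets_le:
  assumes "finite K"
  shows "card {A. A \<subseteq> K \<and> card A < m} \<le> (card K + 1) ^ m"
proof (induction m)
  case (Suc m)
  let ?P = "\<lambda>m. {A. A \<subseteq> K \<and> card A < m}"
  have fin: "finite (?P m)" for m using assms by simp
  have "A \<in> insert {} ((\<lambda>(x, A). insert x A) ` (K \<times> ?P m))" if A: "A \<in> ?P (Suc m)" for A
  proof (cases "A = {}")
    case False
    then obtain x where x: "x \<in> A" by blast
    have "finite A" using A assms finite_subset by blast
    with x A card_Suc_Diff1[of A x] have "card (A - {x}) < m" by simp
    with x A have "A = (\<lambda>(x, A). insert x A) (x, A - {x})" "(x, A - {x}) \<in> K \<times> ?P m" by auto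
    then show ?thesis by blast
  qed simp
  then have "card (?P (Suc m)) \<le> card (insert {} ((\<lambda>(x, A). insert x A) ` (K \<times> ?P m)))"
    using assms fin by (intro card_mono) auto
  also have "\<dots> \<le> Suc (card (K \<times> ?P m))"
    using assms fin card_image_le[of "K \<times> ?P m" "\<lambda>(x, A). insert x A"]
    by (simp add: card_insert_if)
  also have "\<dots> \<le> Suc (card K * (card K + 1) ^ m)"
    using Suc by (simp add: card_cartesian_product)
  also have "\<dots> \<le> (card K + 1) ^ Suc m" by simp
  finally show ?case .
qed simp

text \<open>Shattering passes to subsets, so every shattered subset of \<open>K\<close> has fewer
  than \<open>m\<close> points, and there are only polynomially many of those.\<close>

lemma Sauer_Shelah:
  assumes "finite K" and "\<And>A. A \<subseteq> K \<Longrightarrow> card A = m \<Longrightarrow> \<not> shattered \<G> A"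
  shows "card ((\<lambda>G. G \<inter> K) ` \<G>) \<le> (card K + 1) ^ m"
proof -
  let ?F = "(\<lambda>G. G \<inter> K) ` \<G>"
  have "card ?F \<le> card {A. A \<subseteq> K \<and> shattered ?F A}"
    by (rule card_le_card_shattered) (use assms in auto)
  also have "\<dots> \<le> card {A. A \<subseteq> K \<and> card A < m}"
  proof (intro card_mono subsetI)
    fix A assume A: "A \<in> {A. A \<subseteq> K \<and> shattered ?F A}"
    have "card A < m"
    proof (rule ccontr)
      assume "\<not> card A < m"
      then obtain A' where A': "A' \<subseteq> A" "card A' = m" using obtain_subset_with_card_n not_less by metis
      have "shattered \<G> A'" unfolding shattered_def
      proof (intro allI impI)
        fix S assume "S \<subseteq> A'"
        with A' have "S \<subseteq> A" by blast
        with A have "\<exists>G\<in>?F. G \<inter> A = S" by (simp only: shattered_def mem_Collect_eq)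
        then obtain G where G: "G \<in> \<G>" "G \<inter> K \<inter> A = S" by blast
        then have "G \<inter> A' = S" using \<open>S \<subseteq> A'\<close> A A'(1) by blast
        with G show "\<exists>G\<in>\<G>. G \<inter> A' = S" by blast
      qed
      with assms(2)[of A'] A A' show False by auto
    qed
    with A show "A \<in> {A. A \<subseteq> K \<and> card A < m}" by simp
  qed (use assms in auto)
  also have "\<dots> \<le> (card K + 1) ^ m" by (rule card_small_subsets_le) fact
  finally show ?thesis .
qed

text \<open>On \<open>B\<close>, \<open>f\<close> factors through the joint map sending
  \<open>b\<close> to all values \<open>g v b\<close>.\<close>

lemma card_image_le_prod:
  assumes "finite V" and "finite B"
    and "\<And>b b'. b \<in> B \<Longrightarrow> b' \<in> B \<Longrightarrow> (\<And>v. v \<in> V \<Longrightarrow> g v b = g v b') \<Longrightarrow> f b = f b'"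
  shows "card (f ` B) \<le> (\<Prod>v\<in>V. card (g v ` B))"
proof -
  let ?g = "\<lambda>b. \<lambda>v\<in>V. g v b"
  define h where "h y = f (SOME b. b \<in> B \<and> ?g b = y)" for y
  have "f b = h (?g b)" if "b \<in> B" for b
  proof -
    let ?b = "SOME b'. b' \<in> B \<and> ?g b' = ?g b"
    have "?b \<in> B \<and> ?g ?b = ?g b" by (rule someI[of _ b]) (use that in auto)
    then have b: "?b \<in> B" and eq: "?g ?b = ?g b" by blast+
    have "g v b = g v ?b" if "v \<in> V" for v using fun_cong[OF eq, of v] that by simp
    from assms(3)[OF \<open>b \<in> B\<close> b this] show ?thesis by (simp add: h_def)
  qed
  then have "f ` B = h ` ?g ` B" by (auto simp: image_iff)
  then have "card (f ` B) \<le> card (?g ` B)" using assms by (metis card_image_le finite_imageI)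
  also have "\<dots> \<le> card (PiE V (\<lambda>v. g v ` B))"
    using assms by (intro card_mono finite_PiE) auto
  also have "\<dots> = (\<Prod>v\<in>V. card (g v ` B))" using assms by (simp add: card_PiE)
  finally show ?thesis .
qed

lemma exponential_beats_polynomial:
  assumes "M > (0::nat)"
  shows "\<exists>k. M ^ k * (c * (k + 1) ^ d) < (M + 1 :: nat) ^ k"
proof -
  define x where "x = real M / real (M + 1)"
  \<comment> \<open>The root reduces the claim to the limit of \<open>k * y ^ k\<close>:
    \<open>(k + 1) ^ d * x ^ k\<close> is at most
    \<open>((k + 1) * y ^ k) ^ (d + 1)\<close>.\<close>
  define y where "y = root (d + 1) x"
  have x: "0 < x" "x < 1" using assms by (auto simp: x_def)
  then have y: "0 < y" "y < 1" "y ^ (d + 1) = x" by (simp_all add: y_def del: power_Suc)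
  have "(\<lambda>k. real k * y ^ k + y ^ k) \<longlonglongrightarrow> 0 + 0"
    using y by (intro tendsto_add powser_times_n_limit_0 LIMSEQ_power_zero) auto
  then have "(\<lambda>k. real c * ((real k + 1) * y ^ k) ^ (d + 1)) \<longlonglongrightarrow> real c * 0 ^ (d + 1)"
    by (intro tendsto_intros) (simp add: algebra_simps)
  then have "\<forall>\<^sub>F k in sequentially. real c * ((real k + 1) * y ^ k) ^ (d + 1) < 1"
    by (rule order_tendstoD) simp
  then obtain k where k: "real c * ((real k + 1) * y ^ k) ^ (d + 1) < 1"
    by (auto simp: eventually_sequentially)
  have "(y ^ k) ^ (d + 1) = x ^ k" using y(3) by (metis power_commutes power_mult mult.commute)
  then have "((real k + 1) * y ^ k) ^ (d + 1) = (real k + 1) ^ (d + 1) * x ^ k"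
    by (simp only: power_mult_distrib)
  moreover have "(real k + 1) ^ d * x ^ k \<le> (real k + 1) ^ (d + 1) * x ^ k"
    using x by (intro mult_right_mono power_increasing) auto
  ultimately have "real c * ((real k + 1) ^ d * x ^ k) < 1"
    using k by (smt (verit) mult_left_mono of_nat_0_le_iff)
  then have "real (M ^ k * (c * (k + 1) ^ d)) < real ((M + 1) ^ k)"
    by (simp add: x_def field_simps power_divide)
  then show ?thesis using of_nat_less_iff by blast
qed

section \<open>Ultrafilters and null sets\<close>

text \<open>Zorn's lemma for the reversed order, as smaller filters are finer: a nonempty chain of
  proper filters has a proper infimum, and a minimal proper filter decides every predicate.\<close>

lemma ultrafilter_exists:
  fixes F :: "'a filter"
  assumes "F \<noteq> bot"
  shows "\<exists>U\<le>F. U \<noteq> bot \<and> (\<forall>P. eventually P U \<or> eventually (\<lambda>x. \<not> P x) U)"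
proof -
  let ?A = "{G. G \<le> F \<and> G \<noteq> bot}"
  have "\<exists>U\<in>?A. \<forall>G\<in>?A. G \<le> U \<longrightarrow> G = U"
  proof (rule predicate_Zorn[where P = "\<lambda>x y. y \<le> x" and A = ?A])
    show "partial_order_on ?A (relation_of (\<lambda>x y. y \<le> x) ?A)"
      by (auto simp: partial_order_on_def preorder_on_def refl_on_def trans_def antisym_def relation_of_def)
    fix C assume C: "C \<in> Chains (relation_of (\<lambda>x y. y \<le> x) ?A)"
    then have sub: "C \<subseteq> ?A" and ch: "\<And>G H. G \<in> C \<Longrightarrow> H \<in> C \<Longrightarrow> G \<le> H \<or> H \<le> G"
      by (auto simp: Chains_def relation_of_def)
    show "\<exists>U\<in>?A. \<forall>G\<in>C. U \<le> G"
    proof (cases "C = {}")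
      case False
      have "eventually P (Inf C) \<longleftrightarrow> (\<exists>G\<in>C. eventually P G)" for P
      proof (rule eventually_Inf_base[OF False])
        fix G H assume "G \<in> C" "H \<in> C"
        with ch[of G H] show "\<exists>x\<in>C. x \<le> inf G H" by (metis le_inf_iff order_refl)
      qed
      then have "Inf C \<noteq> bot" using sub by (auto simp: trivial_limit_def)
      moreover have "Inf C \<le> F" using False sub by (metis (no_types, lifting) Inf_lower2 all_not_in_conv mem_Collect_eq subsetD)
      ultimately show ?thesis by (auto intro: Inf_lower)
    qed (use assms in auto)
  qed
  then obtain U where U: "U \<le> F" "U \<noteq> bot" and max: "\<And>G. G \<le> F \<Longrightarrow> G \<noteq> bot \<Longrightarrow> G \<le> U \<Longrightarrow> G = U"
    by blast
  have "eventually P U" if "\<not> eventually (\<lambda>x. \<not> P x) U" for P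
  proof -
    have "inf U (principal {x. P x}) = U"
      using that U(1) by (intro max) (auto simp: trivial_limit_def eventually_inf_principal le_infI1)
    then have "U \<le> principal {x. P x}" by (metis inf.cobounded2)
    then show ?thesis by (simp add: le_principal)
  qed
  with U show ?thesis by blast
qed

text \<open>Two notions of smallness coexist: null sets are closed under unions of \<kappa> many,
  while for sets of size below \<kappa> just finite unions are used, as \<kappa> may be
  singular.\<close>

locale infinite_cardinal =
  fixes \<kappa> :: "'k rel"
  assumes Card: "Card_order \<kappa>" and infinite_Field: "infinite (Field \<kappa>)"
begin

abbreviation null :: "'b set \<Rightarrow> bool" where
  "null A \<equiv> |A| \<le>o \<kappa>"

lemma null_subset: "A \<subseteq> B \<Longrightarrow> null B \<Longrightarrow> null A"
  using card_of_mono1 ordLeq_transitive by blast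

lemma less_subset: "A \<subseteq> B \<Longrightarrow> |B| <o \<kappa> \<Longrightarrow> |A| <o \<kappa>"
  by (rule ordLeq_ordLess_trans[OF card_of_mono1])

lemma null_UNION: "|I| \<le>o \<kappa> \<Longrightarrow> (\<And>i. i \<in> I \<Longrightarrow> null (A i)) \<Longrightarrow> null (\<Union>i\<in>I. A i)"
  using card_of_UNION_ordLeq_infinite_Field[OF infinite_Field Card] by blast

lemma less_imp_null: "|A| <o \<kappa> \<Longrightarrow> null A"
  by (rule ordLess_imp_ordLeq)

lemma finite_less: "finite A \<Longrightarrow> |A| <o \<kappa>"
  using finite_ordLess_infinite[OF card_of_Well_order card_order_on_well_order_on[OF Card], of A]
    infinite_Field by (simp add: Field_card_of)

lemma finite_null: "finite A \<Longrightarrow> null A"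
  by (intro less_imp_null finite_less)

lemma null_Un: "null A \<Longrightarrow> null B \<Longrightarrow> null (A \<union> B)"
  using null_UNION[of "{True, False}" "\<lambda>b. if b then A else B"] finite_null[of "{True, False}"]
  by (simp add: Un_commute)

lemma null_iff_Int_Diff: "null A \<longleftrightarrow> null (A \<inter> U) \<and> null (A - U)"
proof
  assume "null A"
  then show "null (A \<inter> U) \<and> null (A - U)" using null_subset[of "A \<inter> U" A] null_subset[of "A - U" A] by simp
next
  assume "null (A \<inter> U) \<and> null (A - U)"
  then have "null ((A \<inter> U) \<union> (A - U))" using null_Un by blast
  then show "null A" by (simp only: Int_Diff_Un)
qed

lemma null_UNION_finite: "finite I \<Longrightarrow> (\<And>i. i \<in> I \<Longrightarrow> null (A i)) \<Longrightarrow> null (\<Union>i\<in>I. A i)"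
  by (rule null_UNION[OF finite_null])

lemma less_UNION_finite:
  "finite I \<Longrightarrow> (\<And>i. i \<in> I \<Longrightarrow> |A i| <o \<kappa>) \<Longrightarrow> |\<Union>i\<in>I. A i| <o \<kappa>"
proof (induction I rule: finite_induct)
  case empty
  then show ?case by (simp add: finite_less)
next
  case (insert i I)
  then show ?case by (simp add: card_of_Un_ordLess_infinite_Field[OF infinite_Field Card])
qed

lemma not_less_subset:
  assumes "\<not> |A| <o \<kappa>"
  obtains K where "K \<subseteq> A" and "|K| =o \<kappa>"
proof -
  have "\<kappa> \<le>o |A|" 
    using assms not_ordLess_iff_ordLeq card_of_Well_order card_order_on_well_order_on[OF Card] by blast
  then have "|Field \<kappa>| \<le>o |A|" using card_of_Field_ordIso[OF Card] ordIso_ordLeq_trans by blast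
  then obtain K where "K \<subseteq> A" "|Field \<kappa>| =o |K|" using internalize_card_of_ordLeq2[of "Field \<kappa>" A] by auto
  moreover have "|K| =o \<kappa>"
    using calculation card_of_Field_ordIso[OF Card] ordIso_symmetric ordIso_transitive by blast
  ultimately show ?thesis using that by blast
qed

text \<open>\<open>X\<close> is in bijection with \<open>X \<times> Field \<kappa>\<close>, whose
  slices \<open>X \<times> {i}\<close> are disjoint copies of \<open>X\<close>.\<close>

lemma not_null_disjoint_family:
  assumes "\<not> null X"
  obtains Z where "\<And>i. i \<in> Field \<kappa> \<Longrightarrow> Z i \<subseteq> X" and "\<And>i. i \<in> Field \<kappa> \<Longrightarrow> \<not> null (Z i)"
    and "disjoint_family_on Z (Field \<kappa>)"
proof -
  have ne: "Field \<kappa> \<noteq> {}" using infinite_Field by auto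
  have inf: "infinite X" using assms finite_null by blast
  have "\<kappa> \<le>o |X|"
    using assms ordLeq_total[OF card_of_Well_order card_order_on_well_order_on[OF Card]] by blast
  then have "|Field \<kappa>| \<le>o |X|" using card_of_Field_ordIso[OF Card] ordIso_ordLeq_trans by blast
  then have "|X \<times> Field \<kappa>| =o |X|" using card_of_Times_infinite[OF inf ne] by blast
  then obtain h where h: "bij_betw h (X \<times> Field \<kappa>) X" using card_of_ordIso by blast
  define Z where "Z i = h ` (X \<times> {i})" for i
  have sub: "Z i \<subseteq> X" if "i \<in> Field \<kappa>" for i
    using h that by (auto simp: Z_def bij_betw_def)
  have "\<not> null (Z i)" if "i \<in> Field \<kappa>" for i
  proof
    assume "null (Z i)"
    moreover have "bij_betw (\<lambda>x. h (x, i)) X (Z i)"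
      using h that by (auto simp: Z_def bij_betw_def inj_on_def)
    then have "|X| =o |Z i|" using card_of_ordIso by blast
    ultimately show False using assms ordIso_ordLeq_trans by blast
  qed
  moreover have "disjoint_family_on Z (Field \<kappa>)"
    using h unfolding disjoint_family_on_def Z_def bij_betw_def inj_on_def by fastforce
  ultimately show ?thesis using that sub by blast
qed

text \<open>Each \<open>H b\<close> misses one of \<open>\<kappa>\<close> many disjoint non-null sets; the pigeonhole principle
  then finds a common one for non-null many \<open>b\<close>.\<close>

lemma not_null_avoiding_pair:
  assumes "\<not> null X" and "\<And>b. b \<in> X \<Longrightarrow> |X \<inter> H b| <o \<kappa>"
  shows "\<exists>Y Z. Y \<subseteq> X \<and> Z \<subseteq> X \<and> \<not> null Y \<and> \<not> null Z \<and> (\<forall>b\<in>Y. Z \<inter> H b = {})"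
proof -
  obtain Z where Z: "\<And>i. i \<in> Field \<kappa> \<Longrightarrow> Z i \<subseteq> X" "\<And>i. i \<in> Field \<kappa> \<Longrightarrow> \<not> null (Z i)"
    and disj: "disjoint_family_on Z (Field \<kappa>)"
    using not_null_disjoint_family[OF assms(1)] by metis
  define Y where "Y i = {b \<in> X. Z i \<inter> H b = {}}" for i
  have "X \<subseteq> (\<Union>i\<in>Field \<kappa>. Y i)"
  proof
    fix b assume b: "b \<in> X"
    show "b \<in> (\<Union>i\<in>Field \<kappa>. Y i)"
    proof (rule ccontr)
      assume "b \<notin> (\<Union>i\<in>Field \<kappa>. Y i)"
      then have "\<forall>i\<in>Field \<kappa>. \<exists>a. a \<in> Z i \<inter> H b" using b by (auto simp: Y_def)
      \<comment> \<open>One point from each of the disjoint \<open>Z i\<close> would embed \<kappa>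
        into \<open>X \<inter> H b\<close>, which is smaller than \<kappa>.\<close>
      then obtain f where f: "\<And>i. i \<in> Field \<kappa> \<Longrightarrow> f i \<in> Z i \<inter> H b" by metis
      have "inj_on f (Field \<kappa>)"
      proof (rule inj_onI, rule ccontr)
        fix i j assume ij: "i \<in> Field \<kappa>" "j \<in> Field \<kappa>" "f i = f j" "i \<noteq> j"
        then have "Z i \<inter> Z j = {}" using disjoint_family_onD[OF disj] by blast
        moreover have "f i \<in> Z i \<inter> Z j" using f[of i] f[of j] ij by simp
        ultimately show False by blast
      qed
      moreover have "f ` Field \<kappa> \<subseteq> X \<inter> H b" using f Z by blast
      ultimately have "|Field \<kappa>| \<le>o |X \<inter> H b|" using card_of_ordLeq by blast
      then have "|Field \<kappa>| <o \<kappa>" using assms(2)[OF b] ordLeq_ordLess_trans by blast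
      then show False using card_of_Field_ordIso[OF Card] not_ordLess_ordIso by blast
    qed
  qed
  then have "\<not> null (\<Union>i\<in>Field \<kappa>. Y i)" using assms(1) null_subset[of X] by blast
  moreover have "|Field \<kappa>| \<le>o \<kappa>" using card_of_Field_ordIso[OF Card] ordIso_iff_ordLeq by blast
  ultimately obtain i where "i \<in> Field \<kappa>" "\<not> null (Y i)" using null_UNION by blast
  with Z show ?thesis by (intro exI[of _ "Y i"] exI[of _ "Z i"]) (auto simp: Y_def)
qed

text \<open>A proper filter finer than this one contains \<open>S\<close> and avoids every null set,
  so it describes a generic point of \<open>S\<close>.\<close>

definition conull :: "'b set \<Rightarrow> 'b filter" where
  "conull S = Abs_filter (\<lambda>P. null {b \<in> S. \<not> P b})"

lemma eventually_conull:
  fixes S :: "'b set"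
  shows "eventually P (conull S) \<longleftrightarrow> null {b \<in> S. \<not> P b}"
  unfolding conull_def
proof (rule eventually_Abs_filter, rule is_filter.intro)
  show "null {b \<in> S. \<not> True}" by (simp add: finite_null)
next
  fix P Q :: "'b \<Rightarrow> bool" assume "null {b \<in> S. \<not> P b}" "null {b \<in> S. \<not> Q b}"
  then show "null {b \<in> S. \<not> (P b \<and> Q b)}"
    by (rule null_subset[OF _ null_Un, rotated]) auto
next
  fix P Q :: "'b \<Rightarrow> bool" assume "\<forall>x. P x \<longrightarrow> Q x" "null {b \<in> S. \<not> P b}"
  then show "null {b \<in> S. \<not> Q b}" by (auto intro: null_subset[rotated])
qed

lemma conull_eq_bot_iff: "conull S = bot \<longleftrightarrow> null S"
  by (simp add: trivial_limit_def eventually_conull)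

section \<open>Rarely split partitions\<close>

text \<open>The atoms that the sets \<open>T e\<close> cut out of \<open>Y\<close>, possibly empty.
  Indexing them by traces keeps the counting inside \<open>Pow E\<close>.\<close>

definition cell :: "('e \<Rightarrow> 'b set) \<Rightarrow> 'b set \<Rightarrow> 'e set \<Rightarrow> 'e set \<Rightarrow> 'b set" where
  "cell T Y E p = {b \<in> Y. {e \<in> E. b \<in> T e} = p}"

definition non_null_cells :: "('e \<Rightarrow> 'b set) \<Rightarrow> 'b set \<Rightarrow> 'e set \<Rightarrow> 'e set set" where
  "non_null_cells T Y E = {p \<in> Pow E. \<not> null (cell T Y E p)}"

definition splits :: "'b set \<Rightarrow> 'b set \<Rightarrow> bool" where
  "splits U S \<longleftrightarrow> \<not> null (S \<inter> U) \<and> \<not> null (S - U)"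

lemma finite_non_null_cells: "finite E \<Longrightarrow> finite (non_null_cells T Y E)"
  by (simp add: non_null_cells_def)

lemma non_null_cells_nonempty:
  assumes "finite E" and "\<not> null Y"
  shows "non_null_cells T Y E \<noteq> {}"
proof
  assume "non_null_cells T Y E = {}"
  then have "null (\<Union>p\<in>Pow E. cell T Y E p)"
    using assms by (intro null_UNION_finite) (auto simp: non_null_cells_def)
  moreover have "Y \<subseteq> (\<Union>p\<in>Pow E. cell T Y E p)"
  proof
    fix b assume "b \<in> Y"
    then have "b \<in> cell T Y E {e \<in> E. b \<in> T e}" by (simp add: cell_def)
    then show "b \<in> (\<Union>p\<in>Pow E. cell T Y E p)" by (rule UN_I[rotated]) simp
  qed
  ultimately have "null Y" by (rule null_subset[rotated])
  with assms(2) show False ..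
qed

text \<open>\<open>T e\<close> cuts each old cell in two. A non-null cell has at least one non-null
  part, and two exactly when it is split; \<open>P\<close> and \<open>Q\<close> collect the cells
  with non-null inner and outer part.\<close>

lemma card_non_null_cells_insert:
  assumes "finite E" and "e \<notin> E"
  shows "card (non_null_cells T Y (insert e E)) =
    card (non_null_cells T Y E) + card {p \<in> non_null_cells T Y E. splits (T e) (cell T Y E p)}"
proof -
  let ?N = "non_null_cells T Y E" and ?S = "cell T Y E"
  define P where "P = {p \<in> Pow E. \<not> null (?S p \<inter> T e)}"
  define Q where "Q = {p \<in> Pow E. \<not> null (?S p - T e)}"
  have fin: "finite P" "finite Q" using assms by (auto simp: P_def Q_def)
  have trace: "{e' \<in> insert e E. b \<in> T e'} =
      (if b \<in> T e then insert e {e' \<in> E. b \<in> T e'} else {e' \<in> E. b \<in> T e'})" for b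
    by auto
  have in_cell: "cell T Y (insert e E) (insert e p) = ?S p \<inter> T e" if "p \<subseteq> E" for p
  proof -
    have "{e' \<in> insert e E. b \<in> T e'} = insert e p \<longleftrightarrow> {e' \<in> E. b \<in> T e'} = p \<and> b \<in> T e" for b
      unfolding trace using assms(2) that by (auto simp: insert_ident subset_iff)
    then show ?thesis by (auto simp: cell_def)
  qed
  have out_cell: "cell T Y (insert e E) p = ?S p - T e" if "p \<subseteq> E" for p
  proof -
    have "{e' \<in> insert e E. b \<in> T e'} = p \<longleftrightarrow> {e' \<in> E. b \<in> T e'} = p \<and> b \<notin> T e" for b
      unfolding trace using assms(2) that by auto
    then show ?thesis by (auto simp: cell_def)
  qed
  have "r \<in> insert e ` P \<union> Q" if r: "r \<in> non_null_cells T Y (insert e E)" for r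
  proof (cases "e \<in> r")
    case True
    then have "r = insert e (r - {e})" by auto
    moreover have "r - {e} \<subseteq> E" using r by (auto simp: non_null_cells_def)
    moreover from calculation have "r - {e} \<in> P"
      using r in_cell[of "r - {e}"] by (auto simp: P_def non_null_cells_def)
    ultimately show ?thesis by blast
  next
    case False
    then have "r \<subseteq> E" using r by (auto simp: non_null_cells_def)
    then show ?thesis using r out_cell by (auto simp: Q_def non_null_cells_def)
  qed
  moreover have "insert e ` P \<union> Q \<subseteq> non_null_cells T Y (insert e E)"
    using in_cell out_cell by (auto simp: non_null_cells_def P_def Q_def)
  ultimately have "non_null_cells T Y (insert e E) = insert e ` P \<union> Q" by blast
  moreover have "card (insert e ` P \<union> Q) = card (insert e ` P) + card Q"
    using fin assms by (intro card_Un_disjoint) (auto simp: Q_def)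
  moreover have "card (insert e ` P) = card P"
    using assms by (intro card_image) (auto simp: inj_on_def P_def)
  moreover have "card P + card Q = card (P \<union> Q) + card (P \<inter> Q)" by (rule card_Un_Int) fact+
  moreover have "P \<union> Q = ?N"
    unfolding P_def Q_def non_null_cells_def null_iff_Int_Diff[of "?S _" "T e"] by blast
  moreover have "P \<inter> Q = {p \<in> ?N. splits (T e) (?S p)}"
    unfolding P_def Q_def non_null_cells_def splits_def null_iff_Int_Diff[of "?S _" "T e"] by blast
  ultimately show ?thesis by simp
qed

text \<open>Otherwise one could keep adding an index that splits a fraction of at least \<open>1/M\<close> of the
  cells, which makes the number of cells grow exponentially.\<close>

lemma rarely_split_cells:
  fixes T :: "'e \<Rightarrow> 'b set"
  assumes Y: "\<not> null Y" and M: "M > 0"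
    and growth: "\<And>E. E \<subseteq> I \<Longrightarrow> finite E \<Longrightarrow> \<exists>W. null W \<and>
      (\<forall>B. finite B \<longrightarrow> B \<subseteq> Y - W \<longrightarrow> card ((\<lambda>b. {e \<in> E. b \<in> T e}) ` B) \<le> c * (card E + 1) ^ d)"
  shows "\<exists>E\<subseteq>I. finite E \<and> (\<forall>e\<in>I.
    M * card {p \<in> non_null_cells T Y E. splits (T e) (cell T Y E p)} < card (non_null_cells T Y E))"
proof (rule ccontr)
  let ?N = "non_null_cells T Y"
  let ?s = "\<lambda>e E. card {p \<in> ?N E. splits (T e) (cell T Y E p)}"
  assume neg: "\<not> ?thesis"
  have many: "\<exists>e\<in>I. card (?N E) \<le> M * ?s e E" if "E \<subseteq> I" "finite E" for E
    using that neg by (auto simp: not_less)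
  \<comment> \<open>Each added index multiplies the number of non-null cells by at least
    \<open>(M + 1) / M\<close>; denominators are cleared to stay in the naturals.\<close>
  have "\<exists>E\<subseteq>I. finite E \<and> card E = k \<and> (M + 1) ^ k \<le> M ^ k * card (?N E)" for k
  proof (induction k)
    case 0
    then show ?case using non_null_cells_nonempty[OF _ Y, of "{}" T] finite_non_null_cells[of "{}" T Y]
      by (intro exI[of _ "{}"]) (auto simp: Suc_le_eq card_gt_0_iff)
  next
    case (Suc k)
    then obtain E where E: "E \<subseteq> I" "finite E" "card E = k" "(M + 1) ^ k \<le> M ^ k * card (?N E)" by blast
    then obtain e where e: "e \<in> I" "card (?N E) \<le> M * ?s e E" using many by blast
    have "e \<notin> E"
    proof
      assume "e \<in> E"
      then have "cell T Y E p \<inter> T e = {} \<or> cell T Y E p - T e = {}" for p by (auto simp: cell_def)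
      then have "\<not> splits (T e) (cell T Y E p)" for p
        unfolding splits_def by (metis finite.emptyI finite_null)
      then have "card (?N E) = 0" using e by simp
      then show False
        using non_null_cells_nonempty[OF E(2) Y, of T] finite_non_null_cells[OF E(2), of T Y] by simp
    qed
    have "(M + 1) ^ Suc k \<le> (M + 1) * (M ^ k * card (?N E))"
      unfolding power_Suc using E(4) by (rule mult_left_mono) simp
    also have "\<dots> = M ^ k * (M * card (?N E) + card (?N E))" by (simp add: algebra_simps)
    also have "\<dots> \<le> M ^ k * (M * card (?N E) + M * ?s e E)"
      using e(2) by (intro mult_left_mono add_left_mono) auto
    also have "\<dots> = M ^ Suc k * card (?N (insert e E))"
      using card_non_null_cells_insert[OF E(2) \<open>e \<notin> E\<close>, of T Y] by (simp add: algebra_simps)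
    finally show ?case using E e \<open>e \<notin> E\<close> by (intro exI[of _ "insert e E"]) auto
  qed
  moreover obtain k where k: "M ^ k * (c * (k + 1) ^ d) < (M + 1) ^ k"
    using exponential_beats_polynomial[OF M] by blast
  ultimately obtain E where E: "E \<subseteq> I" "finite E" "card E = k" "(M + 1) ^ k \<le> M ^ k * card (?N E)"
    by blast
  obtain W where W: "null W"
    "\<And>B. finite B \<Longrightarrow> B \<subseteq> Y - W \<Longrightarrow> card ((\<lambda>b. {e \<in> E. b \<in> T e}) ` B) \<le> c * (k + 1) ^ d"
    using growth[OF E(1,2)] E(3) by blast
  \<comment> \<open>One point outside \<open>W\<close> from each non-null cell realizes as many
    traces as there are such cells, and \<open>growth\<close> bounds their number.\<close>
  have "\<exists>b. b \<in> cell T Y E p - W" if "p \<in> ?N E" for p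
    using that W(1) null_subset[of "cell T Y E p" W] by (auto simp: non_null_cells_def)
  then obtain r where r: "\<And>p. p \<in> ?N E \<Longrightarrow> r p \<in> cell T Y E p - W" by metis
  then have "(\<lambda>b. {e \<in> E. b \<in> T e}) ` r ` ?N E = ?N E"
    by (force simp: cell_def image_iff)
  then have "card (?N E) \<le> c * (k + 1) ^ d"
    using W(2)[of "r ` ?N E"] r finite_non_null_cells[OF E(2), of T Y] by (auto simp: cell_def image_subset_iff)
  then have "M ^ k * card (?N E) \<le> M ^ k * (c * (k + 1) ^ d)" by (rule mult_left_mono) simp
  with E(4) k show False by linarith
qed

end

section \<open>Eliminating a parameter\<close>

text \<open>A polynomial bound on the number of cells that finitely many conditions on
  \<open>b\<close> cut out of \<open>B\<close>. Keeping the sets \<open>D\<close> disjoint from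
  \<open>B\<close> gives every \<open>insert b D\<close> exactly \<open>N + 1\<close> points, and
  replacing one \<open>b\<close> by another cannot make a nonconstant tuple constant.\<close>

definition poly_growth :: "'a set \<Rightarrow> nat \<Rightarrow> ('a set \<Rightarrow> 'a set) \<Rightarrow> bool" where
  "poly_growth X N F \<longleftrightarrow> (\<exists>c d. \<forall>E B. finite E \<longrightarrow> finite B \<longrightarrow> B \<subseteq> X \<longrightarrow>
     E \<subseteq> X \<times> {D. D \<subseteq> X \<and> finite D \<and> card D = N \<and> D \<inter> B = {}} \<longrightarrow>
     card ((\<lambda>b. {e \<in> E. fst e \<in> F (insert b (snd e))}) ` B) \<le> c * (card E + 1) ^ d)"

context infinite_cardinal
begin

text \<open>The form in which the hypotheses survive the elimination of a parameter. The relation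
  \<open>H\<close> for constant tuples carries no growth bound and stays the same
  throughout.\<close>

definition covering :: "'a set \<Rightarrow> nat \<Rightarrow> ('a set \<Rightarrow> 'a set) \<Rightarrow> ('a \<Rightarrow> 'a set) \<Rightarrow> bool" where
  "covering X N F H \<longleftrightarrow> \<not> null X \<and>
     (\<forall>D\<subseteq>X. finite D \<longrightarrow> card D = Suc N \<longrightarrow> |X \<inter> F D| <o \<kappa>) \<and>
     (\<forall>b\<in>X. |X \<inter> H b| <o \<kappa>) \<and>
     (\<forall>A\<subseteq>X. finite A \<longrightarrow> card A = Suc (Suc N) \<longrightarrow>
        (\<exists>a\<in>A. a \<in> F (A - {a})) \<or> (\<exists>b\<in>A. \<exists>a\<in>A - {b}. a \<in> H b)) \<and>
     poly_growth X N F"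

lemma not_covering_0: "\<not> covering X 0 F H"
proof
  assume cov: "covering X 0 F H"
  \<comment> \<open>For \<open>N = 0\<close> both relations depend on a single point and merge into
    one binary relation with sections smaller than \<kappa>.\<close>
  define G where "G b = X \<inter> (F {b} \<union> H b)" for b
  have small: "|G b| <o \<kappa>" if "b \<in> X" for b
  proof -
    have "|X \<inter> F {b}| <o \<kappa>" "|X \<inter> H b| <o \<kappa>" using cov that by (simp_all add: covering_def)
    then show ?thesis unfolding G_def Int_Un_distrib
      by (rule card_of_Un_ordLess_infinite_Field[OF infinite_Field Card])
  qed
  have X: "\<not> null X" using cov by (simp add: covering_def)
  then have "\<not> |X| <o \<kappa>" using less_imp_null by blast
  then obtain K where K: "K \<subseteq> X" "|K| =o \<kappa>" by (rule not_less_subset)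
  have nK: "null K" using K(2) by (rule ordIso_imp_ordLeq)
  have "null (\<Union>k\<in>K. G k)"
    using K(1) by (intro null_UNION[OF nK] less_imp_null small) auto
  with nK have "null (K \<union> (\<Union>k\<in>K. G k))" by (rule null_Un)
  then have "\<not> X \<subseteq> K \<union> (\<Union>k\<in>K. G k)" using X null_subset[of X] by metis
  then obtain b where b: "b \<in> X" "b \<notin> K" "b \<notin> (\<Union>k\<in>K. G k)" by auto
  have "k \<in> G b" if k: "k \<in> K" for k
  proof -
    have kb: "k \<noteq> b" "k \<in> X" using k b K(1) by auto
    then have "{k, b} \<subseteq> X" "finite {k, b}" "card {k, b} = Suc (Suc 0)" using b by auto
    then have "(\<exists>a\<in>{k, b}. a \<in> F ({k, b} - {a})) \<or> (\<exists>b'\<in>{k, b}. \<exists>a\<in>{k, b} - {b'}. a \<in> H b')"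
      using cov unfolding covering_def by metis
    moreover have "{k, b} - {k} = {b}" "{k, b} - {b} = {k}" using kb by auto
    ultimately have "k \<in> F {b} \<or> b \<in> F {k} \<or> b \<in> H k \<or> k \<in> H b" by auto
    moreover have "b \<notin> G k" using b(3) k by auto
    ultimately show ?thesis using kb b(1) by (simp add: G_def)
  qed
  then have "K \<subseteq> G b" by (rule subsetI)
  then have "|K| <o \<kappa>" using small[OF b(1)] by (rule less_subset)
  then show False using K(2) not_ordLess_ordIso by metis
qed

text \<open>Integrating out one argument \<open>b\<close> of \<open>F\<close>: a point belongs to the new value at \<open>D\<close> if it
  belongs to \<open>F (insert b D)\<close> for \<open>U p\<close>-almost all \<open>b\<close>, for at least \<open>1/M\<close> of the finitely many
  ultrafilters \<open>U p\<close>.  Ultrafilters (rather than ``almost all \<open>b\<close>'') are needed for polynomial growth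
  to be inherited; since fewer than \<open>1/M\<close> of the cells are split, almost all \<open>b\<close> in some cell then
  behave alike, which keeps the new values smaller than \<open>\<kappa>\<close>.\<close>

lemma covering_reduce:
  assumes cov: "covering X (Suc N) F H"
  shows "\<exists>Z F'. covering Z N F' H"
proof -
  have X: "\<not> null X"
    and F_small: "\<And>D. D \<subseteq> X \<Longrightarrow> finite D \<Longrightarrow> card D = Suc (Suc N) \<Longrightarrow> |X \<inter> F D| <o \<kappa>"
    and H_small: "\<And>b. b \<in> X \<Longrightarrow> |X \<inter> H b| <o \<kappa>"
    and cover: "\<And>A. A \<subseteq> X \<Longrightarrow> finite A \<Longrightarrow> card A = Suc (Suc (Suc N)) \<Longrightarrow>
        (\<exists>a\<in>A. a \<in> F (A - {a})) \<or> (\<exists>b\<in>A. \<exists>a\<in>A - {b}. a \<in> H b)"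
    and poly: "poly_growth X (Suc N) F"
    using cov by (simp_all add: covering_def)
  from poly[unfolded poly_growth_def] obtain c d where "\<forall>E B. finite E \<longrightarrow> finite B \<longrightarrow> B \<subseteq> X \<longrightarrow>
      E \<subseteq> X \<times> {D. D \<subseteq> X \<and> finite D \<and> card D = Suc N \<and> D \<inter> B = {}} \<longrightarrow>
      card ((\<lambda>b. {e \<in> E. fst e \<in> F (insert b (snd e))}) ` B) \<le> c * (card E + 1) ^ d"
    by (elim exE) (rule that)
  note growth = this[rule_format]
  \<comment> \<open>The eliminated parameter will range over \<open>Y\<close>, and \<open>Z\<close>
    becomes the new ground set.\<close>
  have "\<exists>Y Z. Y \<subseteq> X \<and> Z \<subseteq> X \<and> \<not> null Y \<and> \<not> null Z \<and> (\<forall>b\<in>Y. Z \<inter> H b = {})"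
    by (rule not_null_avoiding_pair[OF X]) (rule H_small)
  then obtain Y Z where
    YZ: "Y \<subseteq> X" "Z \<subseteq> X" "\<not> null Y" "\<not> null Z" and H_disj: "\<forall>b\<in>Y. Z \<inter> H b = {}"
    by (elim exE conjE) (rule that)
  note H_disjoint = H_disj[rule_format]
  define T where "T e = {b. fst e \<in> F (insert b (snd e))}" for e :: "'a \<times> 'a set"
  define I where "I = X \<times> {D. D \<subseteq> X \<and> finite D \<and> card D = Suc N}"
  \<comment> \<open>Chosen for the final count over a set \<open>A\<close> of \<open>N + 2\<close>
    points, each contributing two classes of fewer than \<open>card J / M\<close> cells.\<close>
  define M where "M = 2 * (N + 2)"
  have "\<exists>E\<subseteq>I. finite E \<and> (\<forall>e\<in>I.
      M * card {p \<in> non_null_cells T Y E. splits (T e) (cell T Y E p)} < card (non_null_cells T Y E))"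
  proof (rule rarely_split_cells[OF YZ(3)])
    fix E assume E: "E \<subseteq> I" "finite E"
    then have fin: "finite (\<Union>(snd ` E))" by (auto simp: I_def)
    \<comment> \<open>Discarding the finitely many points of the sets in \<open>E\<close> provides
      the disjointness that \<open>growth\<close> demands.\<close>
    have "card ((\<lambda>b. {e \<in> E. b \<in> T e}) ` B) \<le> c * (card E + 1) ^ d"
      if "finite B" "B \<subseteq> Y - \<Union>(snd ` E)" for B
    proof -
      have "E \<subseteq> X \<times> {D. D \<subseteq> X \<and> finite D \<and> card D = Suc N \<and> D \<inter> B = {}}"
        using E(1) that(2) by (fastforce simp: I_def)
      then show ?thesis using growth[OF E(2) that(1)] that(2) YZ(1) by (auto simp: T_def)
    qed
    with fin show "\<exists>W. null W \<and> (\<forall>B. finite B \<longrightarrow> B \<subseteq> Y - W \<longrightarrow>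
        card ((\<lambda>b. {e \<in> E. b \<in> T e}) ` B) \<le> c * (card E + 1) ^ d)"
      by (intro exI[of _ "\<Union>(snd ` E)"]) (simp add: finite_null)
  qed (simp add: M_def)
  then obtain E where E: "E \<subseteq> I" "finite E" and rare: "\<forall>e\<in>I.
      M * card {p \<in> non_null_cells T Y E. splits (T e) (cell T Y E p)} < card (non_null_cells T Y E)"
    by (elim exE conjE) (rule that)
  define J where "J = non_null_cells T Y E"
  define S where "S p = cell T Y E p" for p
  have J: "finite J" "J \<noteq> {}"
    using finite_non_null_cells[OF E(2)] non_null_cells_nonempty[OF E(2) YZ(3)] by (simp_all add: J_def)
  have S: "S p \<subseteq> Y" "\<not> null (S p)" if "p \<in> J" for p
    using that by (auto simp: S_def J_def cell_def non_null_cells_def)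
  have rare: "M * card {p \<in> J. splits (T (a, D)) (S p)} < card J"
    if "a \<in> X" "D \<subseteq> X" "finite D" "card D = Suc N" for a D
    unfolding J_def S_def using that by (intro rare[rule_format]) (simp add: I_def)
  have "\<forall>p\<in>J. \<exists>U\<le>conull (S p). U \<noteq> bot \<and> (\<forall>P. eventually P U \<or> eventually (\<lambda>x. \<not> P x) U)"
    using S(2) by (intro ballI ultrafilter_exists) (simp add: conull_eq_bot_iff)
  from bchoice[OF this] obtain U where "\<forall>p\<in>J. U p \<le> conull (S p) \<and> U p \<noteq> bot \<and>
      (\<forall>P. eventually P (U p) \<or> eventually (\<lambda>x. \<not> P x) (U p))"
    by (elim exE) (rule that)
  then have U: "\<And>p. p \<in> J \<Longrightarrow> U p \<le> conull (S p)" "\<And>p. p \<in> J \<Longrightarrow> U p \<noteq> bot"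
    and ultra: "\<And>p P. p \<in> J \<Longrightarrow> eventually P (U p) \<or> eventually (\<lambda>x. \<not> P x) (U p)"
    by simp_all
  have ev: "eventually P (U p)" if "p \<in> J" "null {b \<in> S p. \<not> P b}" for p P
    using U(1)[OF that(1)] that(2) by (simp add: le_filter_def eventually_conull)
  define Q where "Q e p \<longleftrightarrow> eventually (\<lambda>b. b \<in> T e) (U p)" for e p
  define F' where "F' D = {a. card J \<le> M * card {p \<in> J. Q (a, D) p}}" for D
  \<comment> \<open>If \<open>S p - T e\<close> were not null, then \<open>S p \<inter> T e\<close>
    would be null, as there is no splitting, and the generic \<open>U p\<close> would avoid
    \<open>T e\<close>.\<close>
  have Q_split: "null (S p - T e)" if "p \<in> J" "Q e p" "\<not> splits (T e) (S p)" for p e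
  proof (rule ccontr)
    assume "\<not> null (S p - T e)"
    then have "null (S p \<inter> T e)" using that(3) by (simp add: splits_def)
    moreover have "S p \<inter> T e = {b \<in> S p. \<not> b \<notin> T e}" by auto
    ultimately have "eventually (\<lambda>b. b \<notin> T e) (U p)" using ev[OF that(1)] by simp
    with that(2) have "eventually (\<lambda>b. False) (U p)" unfolding Q_def by eventually_elim simp
    then show False using U(2)[OF that(1)] by (simp add: trivial_limit_def)
  qed
  have F'_small: "|Z \<inter> F' D| <o \<kappa>" if D: "D \<subseteq> Z" "finite D" "card D = Suc N" for D
  proof -
    \<comment> \<open>The points lying in \<open>F (insert b D)\<close> for all but null many
      \<open>b\<close> in \<open>S p\<close>. For \<kappa> many such points, the union of the
      exceptional sets is still null, so one common \<open>b\<close> would make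
      \<open>F (insert b D)\<close> too large.\<close>
    define L where "L p = {a \<in> X. null (S p - T (a, D))}" for p
    have DX: "D \<subseteq> X" using D YZ by blast
    have "|L p| <o \<kappa>" if p: "p \<in> J" for p
    proof (rule ccontr)
      assume "\<not> |L p| <o \<kappa>"
      then obtain K where K: "K \<subseteq> L p" "|K| =o \<kappa>" by (rule not_less_subset)
      have nK: "null K" using K(2) by (rule ordIso_imp_ordLeq)
      have "null (\<Union>a\<in>K. S p - T (a, D))" using K(1) by (intro null_UNION[OF nK]) (auto simp: L_def)
      then have "null (D \<union> (\<Union>a\<in>K. S p - T (a, D)))" using null_Un finite_null[OF D(2)] by metis
      then have "\<not> S p \<subseteq> D \<union> (\<Union>a\<in>K. S p - T (a, D))" using S(2)[OF p] null_subset[of "S p"] by metis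
      then obtain b where b: "b \<in> S p" "b \<notin> D" "\<And>a. a \<in> K \<Longrightarrow> b \<in> T (a, D)" by auto
      have "b \<in> X" using b(1) S(1)[OF p] YZ by auto
      then have "|X \<inter> F (insert b D)| <o \<kappa>" using D DX b(2) by (intro F_small) auto
      moreover have "K \<subseteq> X \<inter> F (insert b D)" using K(1) b(3) by (auto simp: T_def L_def)
      ultimately have "|K| <o \<kappa>" by (rule less_subset[rotated])
      then show False using K(2) not_ordLess_ordIso by metis
    qed
    then have "|\<Union>p\<in>J. L p| <o \<kappa>" by (rule less_UNION_finite[OF J(1)])
    moreover have "Z \<inter> F' D \<subseteq> (\<Union>p\<in>J. L p)"
    proof
      fix a assume a: "a \<in> Z \<inter> F' D"
      then have aX: "a \<in> X" using YZ by auto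
      \<comment> \<open>More cells satisfy \<open>Q\<close> than are split, so some unsplit cell
        satisfies \<open>Q\<close> and has \<open>a\<close> in its \<open>L p\<close>.\<close>
      have "card J \<le> M * card {p \<in> J. Q (a, D) p}" using a by (simp add: F'_def)
      with rare[OF aX DX D(2,3)]
      have "M * card {p \<in> J. splits (T (a, D)) (S p)} < M * card {p \<in> J. Q (a, D) p}"
        by (rule less_le_trans)
      then have "card {p \<in> J. splits (T (a, D)) (S p)} < card {p \<in> J. Q (a, D) p}" by simp
      then have "\<not> {p \<in> J. Q (a, D) p} \<subseteq> {p \<in> J. splits (T (a, D)) (S p)}"
        using J(1) card_mono[of "{p \<in> J. splits (T (a, D)) (S p)}" "{p \<in> J. Q (a, D) p}"] by auto
      then obtain p where p: "p \<in> J" "Q (a, D) p" "\<not> splits (T (a, D)) (S p)" by auto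
      then have "a \<in> L p" using Q_split aX by (simp add: L_def)
      with p(1) show "a \<in> (\<Union>p\<in>J. L p)" by (rule UN_I)
    qed
    ultimately show ?thesis by (rule less_subset[rotated])
  qed
  have cover': "\<exists>a\<in>A. a \<in> F' (A - {a})"
    if A: "A \<subseteq> Z" "finite A" "card A = Suc (Suc N)" and no_H: "\<not> (\<exists>b\<in>A. \<exists>a\<in>A - {b}. a \<in> H b)" for A
  proof (rule ccontr)
    assume neg: "\<not> (\<exists>a\<in>A. a \<in> F' (A - {a}))"
    have AX: "A \<subseteq> X" using A YZ by auto
    let ?sp = "\<lambda>a. {p \<in> J. splits (T (a, A - {a})) (S p)}" and ?Q = "\<lambda>a. {p \<in> J. Q (a, A - {a}) p}"
    \<comment> \<open>Otherwise a generic \<open>b\<close> in the cell would refute the covering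
      condition for \<open>insert b A\<close>.\<close>
    have "\<exists>a\<in>A. p \<in> ?sp a \<union> ?Q a" if p: "p \<in> J" for p
    proof (rule ccontr)
      assume n: "\<not> (\<exists>a\<in>A. p \<in> ?sp a \<union> ?Q a)"
      have nT: "null (S p \<inter> T (a, A - {a}))" if "a \<in> A" for a
      proof (rule ccontr)
        assume "\<not> null (S p \<inter> T (a, A - {a}))"
        then have "null (S p - T (a, A - {a}))" using n that p by (auto simp: splits_def)
        moreover have "S p - T (a, A - {a}) = {b \<in> S p. \<not> b \<in> T (a, A - {a})}" by auto
        ultimately have "Q (a, A - {a}) p" unfolding Q_def using ev[OF p] by simp
        then show False using n that p by auto
      qed
      \<comment> \<open>The \<open>b\<close> to be avoided: points of \<open>A\<close> and those
        with \<open>b \<in> F A\<close>, \<open>b \<in> H a\<close>, or \<open>a\<close> in the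
        value of \<open>F\<close> at the rest of \<open>insert b A\<close>. The case
        \<open>a \<in> H b\<close> is excluded by the choice of \<open>Y\<close> and
        \<open>Z\<close>, pairs inside \<open>A\<close> by \<open>no_H\<close>.\<close>
      define W where "W = A \<union> ((X \<inter> F A) \<union> ((\<Union>a\<in>A. X \<inter> H a) \<union> (\<Union>a\<in>A. S p \<inter> T (a, A - {a}))))"
      have "null W" unfolding W_def
        using A AX
        by (intro null_Un finite_null[of A] less_imp_null[OF F_small] null_UNION_finite nT less_imp_null[OF H_small]) auto
      moreover have "S p \<subseteq> W"
      proof (rule ccontr)
        assume "\<not> S p \<subseteq> W"
        then obtain b where b: "b \<in> S p" "b \<notin> W" by auto
        then have bY: "b \<in> Y" "b \<in> X" "b \<notin> A" using S(1)[OF p] YZ by (auto simp: W_def)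
        have "(\<exists>a\<in>insert b A. a \<in> F (insert b A - {a})) \<or>
            (\<exists>b'\<in>insert b A. \<exists>a\<in>insert b A - {b'}. a \<in> H b')"
          using bY A AX by (intro cover) auto
        then show False
        proof (elim disjE bexE)
          fix a assume a: "a \<in> insert b A" "a \<in> F (insert b A - {a})"
          show False
          proof (cases "a = b")
            case True
            then have "b \<in> F A" using a(2) bY(3) by simp
            then show False using b bY by (simp add: W_def)
          next
            case False
            then have "a \<in> A" "insert b A - {a} = insert b (A - {a})" using a by auto
            then have "b \<in> T (a, A - {a})" using a(2) by (simp add: T_def)
            then show False using b \<open>a \<in> A\<close> by (simp add: W_def)
          qed
        next
          fix b' a assume a: "b' \<in> insert b A" "a \<in> insert b A - {b'}" "a \<in> H b'"
          show False
          proof (cases "b' = b")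
            case True
            then have "a \<in> Z \<inter> H b" using a A(1) by auto
            then show False using H_disjoint[OF bY(1)] by simp
          next
            case False
            then have "b' \<in> A" using a by simp
            show False
            proof (cases "a = b")
              case True
              then show False using b bY a(3) \<open>b' \<in> A\<close> by (simp add: W_def)
            next
              case False
              then show False using a no_H \<open>b' \<in> A\<close> by auto
            qed
          qed
        qed
      qed
      ultimately have "null (S p)" by (rule null_subset[rotated])
      then show False using S(2)[OF p] by simp
    qed
    then have "J \<subseteq> (\<Union>a\<in>A. ?sp a \<union> ?Q a)" by auto
    then have "card J \<le> card (\<Union>a\<in>A. ?sp a \<union> ?Q a)"
      using A(2) J(1) by (intro card_mono) auto
    also have "\<dots> \<le> (\<Sum>a\<in>A. card (?sp a \<union> ?Q a))" by (rule card_UN_le[OF A(2)])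
    also have "\<dots> \<le> (\<Sum>a\<in>A. card (?sp a) + card (?Q a))" by (intro sum_mono card_Un_le)
    finally have "M * card J \<le> (\<Sum>a\<in>A. M * card (?sp a) + M * card (?Q a))"
      by (simp add: sum_distrib_left[symmetric] distrib_left[symmetric])
    also have "\<dots> < (\<Sum>a\<in>A. card J + card J)"
    proof (rule sum_strict_mono[OF A(2)])
      show "A \<noteq> {}" using A(3) by auto
      fix a assume a: "a \<in> A"
      then have "M * card (?sp a) < card J" using AX A by (intro rare) auto
      moreover have "M * card (?Q a) < card J" using neg a by (simp add: F'_def not_le)
      ultimately show "M * card (?sp a) + M * card (?Q a) < card J + card J" by simp
    qed
    also have "\<dots> = M * card J" using A(3) by (simp add: M_def)
    finally show False by simp
  qed
  have "poly_growth Z N F'"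
    unfolding poly_growth_def
  proof (intro exI allI impI)
    fix E0 B
    assume E0: "finite E0" "E0 \<subseteq> Z \<times> {D. D \<subseteq> Z \<and> finite D \<and> card D = N \<and> D \<inter> B = {}}"
      and B: "finite B" "B \<subseteq> Z"
    define g where "g p b = {e \<in> E0. Q (fst e, insert b (snd e)) p}" for p b
    have g_le: "card (g p ` B) \<le> c * (card E0 + 1) ^ d" if p: "p \<in> J" for p
    proof -
      define W where "W = B \<union> \<Union>(snd ` E0)"
      have finW: "finite W" using B(1) E0 by (auto simp: W_def)
      have "\<forall>\<^sub>F b' in U p. b' \<in> T (fst e, insert b (snd e)) \<longleftrightarrow> e \<in> g p b" if "e \<in> E0" for e b
        using ultra[OF p, of "\<lambda>b'. b' \<in> T (fst e, insert b (snd e))"] that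
        by (cases "e \<in> g p b") (auto simp: g_def Q_def)
      \<comment> \<open>Only finitely many statements are involved, so a single fresh
        \<open>b'\<close> in \<open>S p\<close> realizes all truth values prescribed by
        \<open>U p\<close>.\<close>
      then have "\<forall>\<^sub>F b' in U p. \<forall>e\<in>E0. \<forall>b\<in>B. b' \<in> T (fst e, insert b (snd e)) \<longleftrightarrow> e \<in> g p b"
        using E0(1) B(1) by (intro eventually_ball_finite ballI) auto
      moreover have "\<forall>\<^sub>F b' in U p. b' \<in> S p" by (rule ev[OF p]) (simp add: finite_null)
      moreover have "\<forall>\<^sub>F b' in U p. b' \<notin> W"
        by (rule ev[OF p]) (simp add: finite_null finW)
      ultimately have "\<forall>\<^sub>F b' in U p. (\<forall>e\<in>E0. \<forall>b\<in>B. b' \<in> T (fst e, insert b (snd e)) \<longleftrightarrow> e \<in> g p b)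
          \<and> b' \<in> S p \<and> b' \<notin> W"
        by eventually_elim simp
      then obtain b' where b': "b' \<in> S p" "b' \<notin> W"
        and g: "\<And>e b. e \<in> E0 \<Longrightarrow> b \<in> B \<Longrightarrow> b' \<in> T (fst e, insert b (snd e)) \<longleftrightarrow> e \<in> g p b"
        using U(2)[OF p] by (auto dest!: eventually_happens)
      have b'X: "b' \<in> X" using b'(1) S(1)[OF p] YZ by auto
      \<comment> \<open>Absorbing \<open>b'\<close> into the parameter sets turns truth for
        \<open>U p\<close> into membership in values of \<open>F\<close>, to which
        \<open>growth\<close> applies; freshness of \<open>b'\<close> gives size
        \<open>Suc N\<close> and disjointness from \<open>B\<close>.\<close>
      define \<iota> where "\<iota> e = (fst e, insert b' (snd e))" for e :: "'a \<times> 'a set"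
      define tr where "tr b = {e \<in> \<iota> ` E0. fst e \<in> F (insert b (snd e))}" for b
      have "\<iota> e \<in> X \<times> {D. D \<subseteq> X \<and> finite D \<and> card D = Suc N \<and> D \<inter> B = {}}" if e: "e \<in> E0" for e
      proof -
        have "b' \<notin> snd e" "b' \<notin> B" using b'(2) e by (auto simp: W_def)
        moreover have "fst e \<in> Z" "snd e \<subseteq> Z" "finite (snd e)" "card (snd e) = N" "snd e \<inter> B = {}"
          using subsetD[OF E0(2) e] by (auto simp: mem_Times_iff)
        ultimately show ?thesis using b'X YZ(2) by (auto simp: \<iota>_def)
      qed
      then have "\<iota> ` E0 \<subseteq> X \<times> {D. D \<subseteq> X \<and> finite D \<and> card D = Suc N \<and> D \<inter> B = {}}" by (rule image_subsetI)
      moreover have "B \<subseteq> X" using B(2) YZ(2) by (rule subset_trans)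
      ultimately have tr_le: "card (tr ` B) \<le> c * (card (\<iota> ` E0) + 1) ^ d"
        unfolding tr_def using E0(1) B(1) by (intro growth) auto
      have "g p b = {e \<in> E0. \<iota> e \<in> tr b}" if b: "b \<in> B" for b
      proof -
        have "\<iota> e \<in> tr b \<longleftrightarrow> e \<in> g p b" if "e \<in> E0" for e
          using g[OF that b] that by (simp add: tr_def \<iota>_def T_def insert_commute)
        then show ?thesis by (auto simp: g_def)
      qed
      then have "g p ` B = (\<lambda>C. {e \<in> E0. \<iota> e \<in> C}) ` tr ` B" by (simp add: image_image cong: image_cong)
      then have "card (g p ` B) \<le> card (tr ` B)" using B(1) by (simp add: card_image_le)
      also note tr_le
      also have "c * (card (\<iota> ` E0) + 1) ^ d \<le> c * (card E0 + 1) ^ d"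
        using E0(1) by (intro mult_left_mono power_mono add_right_mono card_image_le) auto
      finally show ?thesis .
    qed
    \<comment> \<open>\<open>F'\<close> depends only on which \<open>p\<close> satisfy
      \<open>Q\<close>, so the traces \<open>g p b\<close> determine that of \<open>b\<close>. The
      product stays polynomial because \<open>J\<close> depends on neither \<open>E0\<close> nor
      \<open>B\<close>.\<close>
    have "card ((\<lambda>b. {e \<in> E0. fst e \<in> F' (insert b (snd e))}) ` B) \<le> (\<Prod>p\<in>J. card (g p ` B))"
    proof (rule card_image_le_prod[OF J(1) B(1)])
      fix b b' assume eq: "\<And>p. p \<in> J \<Longrightarrow> g p b = g p b'"
      have "{p \<in> J. Q (fst e, insert b (snd e)) p} = {p \<in> J. Q (fst e, insert b' (snd e)) p}"
        if "e \<in> E0" for e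
        using eq that by (auto simp: g_def)
      then show "{e \<in> E0. fst e \<in> F' (insert b (snd e))} = {e \<in> E0. fst e \<in> F' (insert b' (snd e))}"
        by (auto simp: F'_def)
    qed
    also have "\<dots> \<le> (\<Prod>p\<in>J. c * (card E0 + 1) ^ d)" by (intro prod_mono conjI g_le) auto
    also have "\<dots> = c ^ card J * (card E0 + 1) ^ (d * card J)"
      by (simp add: power_mult_distrib power_mult)
    finally show "card ((\<lambda>b. {e \<in> E0. fst e \<in> F' (insert b (snd e))}) ` B)
      \<le> c ^ card J * (card E0 + 1) ^ (d * card J)" .
  qed
  moreover have "\<And>b. b \<in> Z \<Longrightarrow> |Z \<inter> H b| <o \<kappa>"
  proof -
    fix b assume "b \<in> Z"
    then have "|X \<inter> H b| <o \<kappa>" using H_small YZ(2) by auto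
    moreover have "Z \<inter> H b \<subseteq> X \<inter> H b" using YZ(2) by auto
    ultimately show "|Z \<inter> H b| <o \<kappa>" by (rule less_subset[rotated])
  qed
  ultimately have "covering Z N F' H"
    unfolding covering_def using YZ(4) F'_small cover' by metis
  then show ?thesis by metis
qed

lemma not_covering: "\<not> covering X N F H"
proof (induction N arbitrary: X F)
  case (Suc N)
  then show ?case using covering_reduce by metis
qed (rule not_covering_0)

end

section \<open>Polynomial growth in the absence of IP\<close>

text \<open>Sort the tuples by the set \<open>v\<close> of positions holding \<open>b\<close>. For
  each relevant \<open>v\<close>, failure of IP with parameter variables \<open>v\<close> bounds the
  traces of constant parameter tuples by the Sauer-Shelah lemma; the finitely many bounds are
  multiplied.\<close>

lemma poly_growth_tuples:
  fixes R :: "(nat \<Rightarrow> 'a) set"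
  assumes no_IP: "\<And>u v. u \<union> v = {1..<n} \<Longrightarrow> u \<inter> v = {} \<Longrightarrow> u \<noteq> {} \<Longrightarrow> v \<noteq> {} \<Longrightarrow>
    \<not> has_IP X R (insert 0 u) v"
  shows "poly_growth X N (\<lambda>D. {a. \<exists>t \<in> {1..<n} \<rightarrow>\<^sub>E D. \<not> (\<exists>b. \<forall>i\<in>{1..<n}. t i = b) \<and> t(0 := a) \<in> R})"
    (is "poly_growth X N ?F")
proof -
  \<comment> \<open>For \<open>v = {}\<close> the condition does not involve \<open>b\<close>, and
    \<open>v = {1..<n}\<close> cannot occur for a nonconstant tuple.\<close>
  define V where "V = {v. v \<subseteq> {1..<n} \<and> v \<noteq> {} \<and> v \<noteq> {1..<n}}"
  define \<G> where "\<G> v = {solution_set X R (insert 0 ({1..<n} - v)) b | b. b \<in> v \<rightarrow>\<^sub>E X}" for v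
  have finV: "finite V" by (simp add: V_def)
  have "\<forall>v\<in>V. \<exists>m. \<not> (\<exists>A. A \<subseteq> (insert 0 ({1..<n} - v) \<rightarrow>\<^sub>E X) \<and> finite A \<and> card A = m \<and>
      shattered (\<G> v) A)"
  proof
    fix v assume "v \<in> V"
    then have "\<not> has_IP X R (insert 0 ({1..<n} - v)) v" by (intro no_IP) (auto simp: V_def)
    then show "\<exists>m. \<not> (\<exists>A. A \<subseteq> (insert 0 ({1..<n} - v) \<rightarrow>\<^sub>E X) \<and> finite A \<and> card A = m \<and>
        shattered (\<G> v) A)"
      unfolding has_IP_def \<G>_def not_all .
  qed
  from bchoice[OF this] obtain m where "\<forall>v\<in>V. \<not> (\<exists>A. A \<subseteq> (insert 0 ({1..<n} - v) \<rightarrow>\<^sub>E X) \<and>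
      finite A \<and> card A = m v \<and> shattered (\<G> v) A)"
    by (elim exE) (rule that)
  then have m: "\<not> shattered (\<G> v) A"
    if "v \<in> V" "A \<subseteq> (insert 0 ({1..<n} - v) \<rightarrow>\<^sub>E X)" "finite A" "card A = m v" for v A
    using that by blast
  \<comment> \<open>Bounds the number of tuples from one set of \<open>N\<close> points, whatever
    the positions; the base \<open>N + 1\<close> keeps powers monotone in the exponent even for
    \<open>N = 0\<close>.\<close>
  define q where "q = (N + 1) ^ n"
  show ?thesis
    unfolding poly_growth_def
  proof (intro exI allI impI)
    fix E B
    assume E: "finite E" "E \<subseteq> X \<times> {D. D \<subseteq> X \<and> finite D \<and> card D = N \<and> D \<inter> B = {}}"
      and B: "finite B" "B \<subseteq> X"
    have ED: "fst e \<in> X" "snd e \<subseteq> X" "finite (snd e)" "card (snd e) = N" "snd e \<inter> B = {}"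
      if "e \<in> E" for e using subsetD[OF E(2) that] by (auto simp: mem_Times_iff)
    \<comment> \<open>The relevant object tuples: variable 0 takes the point of \<open>e\<close>,
      the positions outside \<open>v\<close> take values in its set.\<close>
    define K where "K v = (\<Union>e\<in>E. (\<lambda>t. t(0 := fst e)) ` (({1..<n} - v) \<rightarrow>\<^sub>E snd e))" for v
    define g where "g v b = solution_set X R (insert 0 ({1..<n} - v)) (\<lambda>i\<in>v. b) \<inter> K v" for v b
    have g_le: "card (g v ` B) \<le> (q * (card E + 1)) ^ m v" if v: "v \<in> V" for v
    proof -
      have finK: "finite (K v)" unfolding K_def using E(1) ED(3) by (intro finite_UN_I finite_imageI finite_PiE) auto
      have KX: "K v \<subseteq> (insert 0 ({1..<n} - v) \<rightarrow>\<^sub>E X)"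
      proof
        fix x assume "x \<in> K v"
        then obtain e t where e: "e \<in> E" "t \<in> ({1..<n} - v) \<rightarrow>\<^sub>E snd e" "x = t(0 := fst e)"
          unfolding K_def by auto
        have "t \<in> ({1..<n} - v) \<rightarrow>\<^sub>E X" using e(2) ED(2)[OF e(1)] by (auto simp: PiE_iff)
        then show "x \<in> insert 0 ({1..<n} - v) \<rightarrow>\<^sub>E X"
          unfolding e(3) using ED(1)[OF e(1)] by (rule PiE_fun_upd[rotated])
      qed
      have "card ((\<lambda>t. t(0 := fst e)) ` (({1..<n} - v) \<rightarrow>\<^sub>E snd e)) \<le> q" if e: "e \<in> E" for e
      proof -
        have "card ((\<lambda>t. t(0 := fst e)) ` (({1..<n} - v) \<rightarrow>\<^sub>E snd e)) \<le> card (({1..<n} - v) \<rightarrow>\<^sub>E snd e)"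
          using ED(3)[OF e] by (intro card_image_le finite_PiE) auto
        also have "\<dots> = N ^ card ({1..<n} - v)" using ED(4)[OF e] by (simp add: card_PiE)
        also have "\<dots> \<le> (N + 1) ^ card ({1..<n} - v)" by (rule power_mono) auto
        also have "\<dots> \<le> (N + 1) ^ n"
          using card_mono[of "{1..<n}" "{1..<n} - v"] by (intro power_increasing) auto
        finally show ?thesis by (simp add: q_def)
      qed
      then have "(\<Sum>e\<in>E. card ((\<lambda>t. t(0 := fst e)) ` (({1..<n} - v) \<rightarrow>\<^sub>E snd e))) \<le> (\<Sum>e\<in>E. q)"
        by (rule sum_mono)
      then have "card (K v) \<le> card E * q"
        unfolding K_def using card_UN_le[OF E(1)] order_trans by fastforce
      moreover have "1 \<le> q" by (simp add: q_def)
      ultimately have "card (K v) + 1 \<le> q * (card E + 1)" by (simp add: algebra_simps)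
      have "g v ` B \<subseteq> (\<lambda>G. G \<inter> K v) ` \<G> v"
      proof (rule image_subsetI)
        fix b assume "b \<in> B"
        then have "(\<lambda>i\<in>v. b) \<in> v \<rightarrow>\<^sub>E X" using B(2) by auto
        then have "solution_set X R (insert 0 ({1..<n} - v)) (\<lambda>i\<in>v. b) \<in> \<G> v"
          unfolding \<G>_def by (intro CollectI exI[of _ "\<lambda>i\<in>v. b"] conjI) simp
        then show "g v b \<in> (\<lambda>G. G \<inter> K v) ` \<G> v" unfolding g_def by (rule imageI)
      qed
      moreover have "finite ((\<lambda>G. G \<inter> K v) ` \<G> v)"
        by (rule finite_subset[of _ "Pow (K v)"]) (use finK in auto)
      ultimately have "card (g v ` B) \<le> card ((\<lambda>G. G \<inter> K v) ` \<G> v)" by (rule card_mono[rotated])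
      also have "\<dots> \<le> (card (K v) + 1) ^ m v"
      proof (rule Sauer_Shelah[OF finK])
        fix A assume A: "A \<subseteq> K v" "card A = m v"
        then show "\<not> shattered (\<G> v) A"
          using KX finK by (intro m[OF v]) (auto intro: finite_subset)
      qed
      also have "\<dots> \<le> (q * (card E + 1)) ^ m v"
        using \<open>card (K v) + 1 \<le> q * (card E + 1)\<close> by (rule power_mono) simp
      finally show ?thesis .
    qed
    \<comment> \<open>Substituting \<open>b'\<close> for \<open>b\<close> at the positions
      \<open>v\<close> keeps the tuple in \<open>R\<close>, since \<open>g v b = g v b'\<close>
      records this membership.\<close>
    have step: "{e \<in> E. fst e \<in> ?F (insert b (snd e))} \<subseteq> {e \<in> E. fst e \<in> ?F (insert b' (snd e))}"
      if b: "b \<in> B" and b': "b' \<in> B" and eq: "\<And>v. v \<in> V \<Longrightarrow> g v b = g v b'" for b b'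
    proof
      fix e assume "e \<in> {e \<in> E. fst e \<in> ?F (insert b (snd e))}"
      then obtain t where e: "e \<in> E" and t: "t \<in> {1..<n} \<rightarrow>\<^sub>E insert b (snd e)"
        and nc: "\<not> (\<exists>b. \<forall>i\<in>{1..<n}. t i = b)" and R: "t(0 := fst e) \<in> R"
        by auto
      define v where "v = {i \<in> {1..<n}. t i = b}"
      let ?u = "{1..<n} - v"
      have tu: "t i \<in> snd e" if "i \<in> ?u" for i using PiE_mem[OF t, of i] that by (auto simp: v_def)
      have t_out: "t i = undefined" if "i \<notin> {1..<n}" for i using t that by (rule PiE_arb)
      have v_all: "v \<noteq> {1..<n}"
      proof
        assume "v = {1..<n}"
        then have "\<forall>i\<in>{1..<n}. t i = b" unfolding v_def by auto
        with nc show False by metis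
      qed
      have v_sub: "v \<subseteq> {1..<n}" by (auto simp: v_def)
      have "fst e \<in> ?F (insert b' (snd e))"
      proof (cases "v = {}")
        case True
        then have "t \<in> {1..<n} \<rightarrow>\<^sub>E insert b' (snd e)" using tu t_out by (auto simp: PiE_iff extensional_def)
        with nc R show ?thesis by auto
      next
        case False
        then have v: "v \<in> V" using v_sub v_all by (simp add: V_def)
        define x where "x = (restrict t ?u)(0 := fst e)"
        define s where "s = (\<lambda>i\<in>{1..<n}. if i \<in> v then b' else t i)"
        have r: "restrict t ?u \<in> ?u \<rightarrow>\<^sub>E snd e" using tu by auto
        then have xK: "x \<in> K v" unfolding K_def x_def using e by blast
        have xX: "x \<in> insert 0 ?u \<rightarrow>\<^sub>E X"
          unfolding x_def using ED(1,2)[OF e] tu by (intro PiE_fun_upd) auto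
        have "override_on (\<lambda>i\<in>v. b) x (insert 0 ?u) = t(0 := fst e)"
        proof
          fix i
          show "override_on (\<lambda>i\<in>v. b) x (insert 0 ?u) i = (t(0 := fst e)) i"
            using t_out[of i] by (auto simp: override_on_def x_def v_def)
        qed
        then have "x \<in> g v b" using R xK xX by (simp add: g_def solution_set_def)
        then have "x \<in> g v b'" using eq[OF v] by simp
        then have "override_on (\<lambda>i\<in>v. b') x (insert 0 ?u) \<in> R" by (simp add: g_def solution_set_def)
        moreover have "override_on (\<lambda>i\<in>v. b') x (insert 0 ?u) = s(0 := fst e)"
        proof
          fix i
          show "override_on (\<lambda>i\<in>v. b') x (insert 0 ?u) i = (s(0 := fst e)) i"
            using v_sub by (auto simp: override_on_def x_def s_def)
        qed
        ultimately have "s(0 := fst e) \<in> R" by simp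
        moreover have "s \<in> {1..<n} \<rightarrow>\<^sub>E insert b' (snd e)" using tu by (auto simp: s_def)
        \<comment> \<open>\<open>s\<close> is \<open>b'\<close> on the nonempty \<open>v\<close> and
          has values in \<open>snd e\<close> at the other positions, of which there is at least one;
          \<open>snd e\<close> is disjoint from \<open>B\<close>.\<close>
        moreover have "\<not> (\<exists>c. \<forall>i\<in>{1..<n}. s i = c)"
        proof
          assume "\<exists>c. \<forall>i\<in>{1..<n}. s i = c"
          then obtain c where c: "\<And>i. i \<in> {1..<n} \<Longrightarrow> s i = c" by auto
          obtain i where i: "i \<in> v" using False by blast
          obtain j where j: "j \<in> ?u" using v_all v_sub by blast
          note ij = i j
          then have "s i = b'" "s j = t j" using v_sub by (auto simp: s_def)
          then have "t j = b'" using c[of i] c[of j] ij v_sub by auto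
          then show False using tu[OF ij(2)] ED(5)[OF e] b' by auto
        qed
        ultimately show ?thesis by auto
      qed
      with e show "e \<in> {e \<in> E. fst e \<in> ?F (insert b' (snd e))}" by simp
    qed
    have "card ((\<lambda>b. {e \<in> E. fst e \<in> ?F (insert b (snd e))}) ` B) \<le> (\<Prod>v\<in>V. card (g v ` B))"
    proof (rule card_image_le_prod[OF finV B(1)])
      fix b b' assume "b \<in> B" "b' \<in> B" "\<And>v. v \<in> V \<Longrightarrow> g v b = g v b'"
      then show "{e \<in> E. fst e \<in> ?F (insert b (snd e))} = {e \<in> E. fst e \<in> ?F (insert b' (snd e))}"
        using step[of b b'] step[of b' b] by (intro subset_antisym) auto
    qed
    also have "\<dots> \<le> (\<Prod>v\<in>V. (q * (card E + 1)) ^ m v)" by (intro prod_mono conjI g_le) auto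
    also have "\<dots> = q ^ (\<Sum>v\<in>V. m v) * (card E + 1) ^ (\<Sum>v\<in>V. m v)"
      by (simp only: power_sum power_mult_distrib prod.distrib)
    finally show "card ((\<lambda>b. {e \<in> E. fst e \<in> ?F (insert b (snd e))}) ` B)
      \<le> q ^ (\<Sum>v\<in>V. m v) * (card E + 1) ^ (\<Sum>v\<in>V. m v)" .
  qed
qed

section \<open>Reduction of the theorem to coverings\<close>

theorem lemma4p2:
  fixes \<kappa> :: "'k rel" and X :: "'a set" and n :: nat and R :: "(nat \<Rightarrow> 'a) set"
  assumes "Card_order \<kappa>" and "infinite (Field \<kappa>)"
    and "n \<ge> 1" and "R \<subseteq> {0..<n} \<rightarrow>\<^sub>E X"
    and "cardSuc \<kappa> \<le>o |X|"
    and "\<And>t. t \<in> {1..<n} \<rightarrow>\<^sub>E X \<Longrightarrow> |{a0 \<in> X. t(0 := a0) \<in> R}| <o \<kappa>"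
    and "\<And>A. A \<subseteq> X \<Longrightarrow> finite A \<Longrightarrow> card A = n \<Longrightarrow>
           \<exists>a\<in>A. \<exists>t \<in> {1..<n} \<rightarrow>\<^sub>E (A - {a}). t(0 := a) \<in> R"
  shows "\<exists>u v. u \<union> v = {1..<n} \<and> u \<inter> v = {} \<and> u \<noteq> {} \<and> v \<noteq> {} \<and>
           has_IP X R (insert 0 u) v"
proof (rule ccontr)
  assume neg: "\<not> ?thesis"
  interpret infinite_cardinal \<kappa> by unfold_locales fact+
  note small = assms(6) and cover = assms(7)
  have X: "\<not> null X"
  proof
    assume "null X"
    then have "cardSuc \<kappa> \<le>o \<kappa>" using assms(5) ordLeq_transitive by metis
    then show False using cardSuc_greater[OF assms(1)] not_ordLess_ordLeq by metis
  qed
  consider "n = 1" | N where "n = Suc (Suc N)"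
    using assms(3) by (cases n rule: nat.exhaust; cases "n - 1") auto
  then show False
  proof cases
    case 1
    \<comment> \<open>Without parameter positions the only tuple is undefined everywhere, and
      covering of singletons makes all of \<open>X\<close> its solution set.\<close>
    have "X \<subseteq> {a0 \<in> X. (\<lambda>_. undefined)(0 := a0) \<in> R}"
    proof
      fix a assume a: "a \<in> X"
      then have "\<exists>a'\<in>{a}. \<exists>t \<in> {1..<n} \<rightarrow>\<^sub>E ({a} - {a'}). t(0 := a') \<in> R" using 1 by (intro cover) auto
      then show "a \<in> {a0 \<in> X. (\<lambda>_. undefined)(0 := a0) \<in> R}" using a 1 by (simp add: fun_upd_def)
    qed
    moreover have "null {a0 \<in> X. (\<lambda>_. undefined)(0 := a0) \<in> R}"
      using 1 by (intro less_imp_null small) simp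
    ultimately have "null X" by (rule null_subset)
    with X show False ..
  next
    case 2
    \<comment> \<open>Here \<open>n = N + 2\<close>. Nonconstant tuples go into \<open>F\<close>,
      where failure of IP gives the growth bound, and constant ones into \<open>H\<close>.\<close>
    define F where "F D = {a. \<exists>t \<in> {1..<n} \<rightarrow>\<^sub>E D. \<not> (\<exists>b. \<forall>i\<in>{1..<n}. t i = b) \<and> t(0 := a) \<in> R}" for D
    define H where "H b = {a. (\<lambda>i\<in>{1..<n}. b)(0 := a) \<in> R}" for b
    have "|X \<inter> F D| <o \<kappa>" if D: "D \<subseteq> X" "finite D" for D
    proof -
      have "t \<in> {1..<n} \<rightarrow>\<^sub>E X" if "t \<in> {1..<n} \<rightarrow>\<^sub>E D" for t using that D(1) by (auto simp: PiE_iff)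
      then have "|{a0 \<in> X. t(0 := a0) \<in> R}| <o \<kappa>" if "t \<in> {1..<n} \<rightarrow>\<^sub>E D" for t
        using small that by simp
      moreover have "finite ({1..<n} \<rightarrow>\<^sub>E D)" using D(2) by (simp add: finite_PiE)
      ultimately have "|\<Union>t\<in>{1..<n} \<rightarrow>\<^sub>E D. {a0 \<in> X. t(0 := a0) \<in> R}| <o \<kappa>"
        using less_UNION_finite[of "{1..<n} \<rightarrow>\<^sub>E D" "\<lambda>t. {a0 \<in> X. t(0 := a0) \<in> R}"] by simp
      moreover have "X \<inter> F D \<subseteq> (\<Union>t\<in>{1..<n} \<rightarrow>\<^sub>E D. {a0 \<in> X. t(0 := a0) \<in> R})"
        unfolding F_def by blast
      ultimately show ?thesis by (rule less_subset[rotated])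
    qed
    moreover have "|X \<inter> H b| <o \<kappa>" if "b \<in> X" for b
    proof -
      have "X \<inter> H b = {a0 \<in> X. (\<lambda>i\<in>{1..<n}. b)(0 := a0) \<in> R}" by (auto simp: H_def)
      moreover have "(\<lambda>i\<in>{1..<n}. b) \<in> {1..<n} \<rightarrow>\<^sub>E X" using that by simp
      ultimately show ?thesis using small by metis
    qed
    moreover have "(\<exists>a\<in>A. a \<in> F (A - {a})) \<or> (\<exists>b\<in>A. \<exists>a\<in>A - {b}. a \<in> H b)"
      if A: "A \<subseteq> X" "finite A" "card A = Suc (Suc N)" for A
    proof -
      obtain a t where a: "a \<in> A" and t: "t \<in> {1..<n} \<rightarrow>\<^sub>E (A - {a})" "t(0 := a) \<in> R"
        using cover[OF A(1,2)] A(3) 2 by auto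
      show ?thesis
      proof (cases "\<exists>b. \<forall>i\<in>{1..<n}. t i = b")
        case True
        then obtain b where b: "\<And>i. i \<in> {1..<n} \<Longrightarrow> t i = b" by auto
        have "t = (\<lambda>i\<in>{1..<n}. b)"
        proof
          fix i show "t i = (\<lambda>i\<in>{1..<n}. b) i" using b[of i] PiE_arb[OF t(1), of i] by (simp add: restrict_def)
        qed
        then have "a \<in> H b" using t(2) by (simp add: H_def)
        \<comment> \<open>Position 1 exists because \<open>n\<close> is at least 2, so the constant
          value is an actual entry of \<open>t\<close>.\<close>
        moreover have "b \<in> A - {a}" using b[of 1] PiE_mem[OF t(1), of 1] 2 by simp
        ultimately show ?thesis using a by blast
      next
        case False
        then have "a \<in> F (A - {a})" unfolding F_def using t by blast
        with a show ?thesis by blast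
      qed
    qed
    moreover have "poly_growth X N F"
      unfolding F_def using neg by (intro poly_growth_tuples) blast
    ultimately have "covering X N F H" unfolding covering_def using X by metis
    with not_covering show False by metis
  qed
qed

end
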